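(* Let $k\ge 2$ and let $T$ be a forest with $h$ vertices. If $k=2$ or if $T$ is a tree, then there exists a constant $C=C(k,h)$ such that for all sufficiently large $n$, $$\big|\,\mathrm{nim}_k(n;T)-(k-1)\,\mathrm{ex}(n,T)\,\big|\le C(k,h).$$
   Context: For a $k$-edge-colouring of $K_n$, an edge is a NIM-edge if it is not contained in any copy of $T$ all of whose edges have the same colour; $\mathrm{nim}_k(n;T)$ is the maximum number of NIM-edges over all $k$-edge-colourings of $K_n$. $\mathrm{ex}(n,T)$ is the maximum number of edges of a $T$-free graph on $n$ vertices. *)

theory Defs
  imports Complex_Main "HOL-Library.Ramsey"
begin

(* A graph is a pair of a vertex set and a set of two-element sets of vertices;
   [V]\<^bsup>2\<^esup> (nsets) is the set of all two-element subsets of V. *)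
type_synonym 'a graph = "'a set \<times> 'a set set"

abbreviation verts :: "'a graph \<Rightarrow> 'a set" where "verts \<equiv> fst"
abbreviation edges :: "'a graph \<Rightarrow> 'a set set" where "edges \<equiv> snd"

definition fin_graph :: "'a graph \<Rightarrow> bool" where
  "fin_graph G \<longleftrightarrow> finite (verts G) \<and> edges G \<subseteq> [verts G]\<^bsup>2\<^esup>"

definition complete_graph :: "nat \<Rightarrow> nat graph" where
  "complete_graph n = ({..<n}, [{..<n}]\<^bsup>2\<^esup>)"

definition connected_graph :: "'a graph \<Rightarrow> bool" where
  "connected_graph G \<longleftrightarrow> verts G \<noteq> {} \<and>
     (\<forall>u\<in>verts G. \<forall>v\<in>verts G. (u, v) \<in> {(x, y). {x, y} \<in> edges G}\<^sup>*)"

(* The closing vertex is not repeated in the list. *)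
definition is_cycle :: "'a graph \<Rightarrow> 'a list \<Rightarrow> bool" where
  "is_cycle G xs \<longleftrightarrow> 3 \<le> length xs \<and> distinct xs \<and>
     (\<forall>i<length xs. {xs ! i, xs ! (Suc i mod length xs)} \<in> edges G)"

definition forest :: "'a graph \<Rightarrow> bool" where
  "forest G \<longleftrightarrow> fin_graph G \<and> (\<nexists>xs. is_cycle G xs)"

definition tree :: "'a graph \<Rightarrow> bool" where
  "tree G \<longleftrightarrow> forest G \<and> connected_graph G"

(* The copies of T in G are the not necessarily induced subgraphs of G isomorphic to T. *)
definition copies :: "'a graph \<Rightarrow> 'b graph \<Rightarrow> 'b graph set" where
  "copies T G = {(f ` verts T, (`) f ` edges T) | f.
     inj_on f (verts T) \<and> f ` verts T \<subseteq> verts G \<and> (`) f ` edges T \<subseteq> edges G}"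

(* If T has at least one edge, the set under Max contains 0. If T is edgeless
   with at most n vertices, that set is empty and the value is meaningless. *)
definition ex_num :: "nat \<Rightarrow> 'a graph \<Rightarrow> nat" where
  "ex_num n T = Max {card F | F. F \<subseteq> edges (complete_graph n) \<and> copies T ({..<n}, F) = {}}"

definition edge_colourings :: "nat \<Rightarrow> nat \<Rightarrow> (nat set \<Rightarrow> nat) set" where
  "edge_colourings k n = {c. c ` edges (complete_graph n) \<subseteq> {..<k}}"

definition nim_edges :: "nat \<Rightarrow> (nat set \<Rightarrow> nat) \<Rightarrow> 'a graph \<Rightarrow> nat set set" where
  "nim_edges n c T = {e \<in> edges (complete_graph n).
     \<not> (\<exists>H \<in> copies T (complete_graph n). e \<in> edges H \<and> (\<exists>i. \<forall>e'\<in>edges H. c e' = i))}"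

definition nim :: "nat \<Rightarrow> nat \<Rightarrow> 'a graph \<Rightarrow> nat" where
  "nim k n T = Max {card (nim_edges n c T) | c. c \<in> edge_colourings k n}"

lemma finite_edges_complete_graph: "finite (edges (complete_graph n))"
  by (simp add: complete_graph_def finite_imp_finite_nsets)

lemma ex_num_set:
  fixes T :: "'a graph" and n :: nat
  assumes "edges T \<noteq> {}"
  defines "S \<equiv> {card F | F. F \<subseteq> edges (complete_graph n) \<and> copies T ({..<n}, F) = {}}"
  shows "finite S" "S \<noteq> {}"
proof -
  have "S \<subseteq> card ` Pow (edges (complete_graph n))"
    by (auto simp: S_def)
  then show "finite S"
    by (rule finite_subset) (simp add: finite_edges_complete_graph)
  have "copies T ({..<n}, {}) = {}"
    using assms(1) by (auto simp: copies_def)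
  then show "S \<noteq> {}"
    unfolding S_def by blast
qed

lemma nim_set:
  fixes T :: "'a graph" and k n :: nat
  assumes "0 < k"
  defines "S \<equiv> {card (nim_edges n c T) | c. c \<in> edge_colourings k n}"
  shows "finite S" "S \<noteq> {}"
proof -
  have "S \<subseteq> card ` Pow (edges (complete_graph n))"
    by (auto simp: S_def nim_edges_def)
  then show "finite S"
    by (rule finite_subset) (simp add: finite_edges_complete_graph)
  have "(\<lambda>_. 0) \<in> edge_colourings k n"
    using assms(1) by (auto simp: edge_colourings_def)
  then show "S \<noteq> {}"
    unfolding S_def by blast
qed

end

theory Submission
  imports Defs "HOL-Combinatorics.Permutations"
begin

text \<open>For each colour \<open>l\<close> let the core be the largest vertex set in which every vertex has at least
  \<open>h\<close> neighbours of colour \<open>l\<close>. A forest embeds greedily into a core, with any edge touching the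
  core as a prescribed pendant edge, so the NIM-edges of colour \<open>l\<close> live on the complement \<open>N l\<close>
  of the core and form a \<open>T\<close>-free graph there. If no colour has both \<open>X\<close> and \<open>Y\<close> meeting its core,
  then there are only linearly many edges between \<open>X\<close> and \<open>Y\<close>, hence one of the two has bounded
  size. Apply this to \<open>Y = N i\<close> and the set \<open>X\<close> of vertices lying in \<open>N l\<close> for all \<open>l \<noteq> i\<close>.
  If some \<open>N i\<close> is bounded, colour \<open>i\<close> contributes only a constant. Otherwise all but
  boundedly many vertices lie in at most \<open>k - 2\<close> of the sets \<open>N l\<close>, which gives about
  \<open>(k - 2) p n\<close> NIM-edges, where \<open>p\<close> is the limit of \<open>ex(n, T) / n\<close> for a tree (and does not
  matter for \<open>k = 2\<close>). Conversely, since an extremal graph has only linearly many edges, \<open>k - 1\<close>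
  randomly permuted copies of it overlap in boundedly many edges on average.\<close>

subsection \<open>Copies and Turan numbers\<close>

lemma copies_eq_empty_iff:
  "copies T (V, F) = {} \<longleftrightarrow>
    (\<nexists>f. inj_on f (verts T) \<and> f ` verts T \<subseteq> V \<and> (\<forall>e\<in>edges T. f ` e \<in> F))"
  by (simp add: copies_def image_subset_iff)

lemma copiesI:
  assumes "inj_on f (verts T)" "f ` verts T \<subseteq> V" "\<And>e. e \<in> edges T \<Longrightarrow> f ` e \<in> F"
  shows "(f ` verts T, (`) f ` edges T) \<in> copies T (V, F)"
  unfolding copies_def using assms by (intro CollectI exI[of _ f]) auto

lemma copies_empty_mono:
  assumes "copies T (V, F) = {}" "V' \<subseteq> V" "F' \<subseteq> F"
  shows "copies T (V', F') = {}"
  using assms unfolding copies_eq_empty_iff by (meson subset_iff order_trans)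

text \<open>An embedding into the image pulls back along the inverse of \<open>g\<close>. This lets
  extremal graphs be shifted and permuted without creating copies of \<open>T\<close>.\<close>

lemma copies_image_empty:
  assumes "inj_on g V" "F \<subseteq> [V]\<^bsup>2\<^esup>" "copies T (V, F) = {}"
  shows "copies T (g ` V, (`) g ` F) = {}"
  unfolding copies_eq_empty_iff
proof
  assume "\<exists>f. inj_on f (verts T) \<and> f ` verts T \<subseteq> g ` V \<and> (\<forall>e\<in>edges T. f ` e \<in> (`) g ` F)"
  then obtain f where f: "inj_on f (verts T)" "f ` verts T \<subseteq> g ` V"
      "\<forall>e\<in>edges T. f ` e \<in> (`) g ` F" by blast
  let ?f = "inv_into V g \<circ> f"
  have "inj_on ?f (verts T)"
    using f(1) inj_on_inv_into[OF f(2)] by (rule comp_inj_on)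
  moreover have "?f ` verts T \<subseteq> V"
    unfolding comp_def by (rule image_subsetI, rule inv_into_into) (use f(2) in blast)
  moreover have "\<forall>e\<in>edges T. ?f ` e \<in> F"
  proof
    fix e assume "e \<in> edges T"
    with f(3) obtain d where d: "d \<in> F" "f ` e = g ` d" by auto
    have "d \<subseteq> V" using assms(2) d(1) by (auto simp: nsets_def)
    then have "?f ` e = d"
      unfolding image_comp[symmetric] d(2) by (rule inv_into_image_cancel[OF assms(1)])
    then show "?f ` e \<in> F" using d by simp
  qed
  ultimately show False using assms(3)[unfolded copies_eq_empty_iff] by (metis (no_types))
qed

lemma ex_num_attained:
  assumes "edges T \<noteq> {}"
  obtains F where "F \<subseteq> [{..<n}]\<^bsup>2\<^esup>" "copies T ({..<n}, F) = {}" "card F = ex_num n T"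
  using Max_in[OF ex_num_set[OF assms, of n]]
  unfolding ex_num_def[symmetric] by (auto simp: complete_graph_def)

text \<open>\<open>ex_num\<close> speaks of the vertex set \<open>{..<n}\<close> only. Relabelling
  along a bijection gives the bound on every finite vertex set, in particular on complements of
  cores.\<close>

lemma card_le_ex_num:
  assumes "edges T \<noteq> {}" "finite V" "F \<subseteq> [V]\<^bsup>2\<^esup>" "copies T (V, F) = {}"
  shows "card F \<le> ex_num (card V) T"
proof -
  obtain g where g: "bij_betw g V {..<card V}"
    using ex_bij_betw_finite_nat[OF assms(2)] by (auto simp: atLeast0LessThan)
  have inj: "inj_on g V" and img: "g ` V = {..<card V}"
    using g by (auto simp: bij_betw_def)
  have "inj_on ((`) g) (Pow V)"
    using inj by (rule inj_on_image_Pow)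
  then have inj': "inj_on ((`) g) F"
    by (rule inj_on_subset) (use assms(3) in \<open>auto simp: nsets_def\<close>)
  have "(`) g ` F \<subseteq> [{..<card V}]\<^bsup>2\<^esup>"
  proof (rule image_subsetI)
    fix e assume "e \<in> F"
    then have e: "e \<subseteq> V" "finite e" "card e = 2"
      using assms(3) by (auto simp: nsets_def)
    have "card (g ` e) = 2"
      using e card_image[OF inj_on_subset[OF inj e(1)]] by simp
    then show "g ` e \<in> [{..<card V}]\<^bsup>2\<^esup>"
      using e img by (auto simp: nsets_def)
  qed
  moreover have "copies T ({..<card V}, (`) g ` F) = {}"
    using copies_image_empty[OF inj assms(3,4)] img by simp
  ultimately have "card ((`) g ` F) \<le> ex_num (card V) T"
    unfolding ex_num_def
    by (intro Max_ge ex_num_set(1)[OF assms(1)]) (auto simp: complete_graph_def)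
  then show ?thesis
    using card_image[OF inj'] by simp
qed

subsection \<open>Leaves of forests\<close>

text \<open>The ends of a longest path have all their neighbours on the path, and one of the two
  ends differs from \<open>x\<close>. If that end had two neighbours, the path would close up to a cycle.\<close>

lemma forest_low_degree_vertex:
  assumes "forest T" "S \<subseteq> verts T" "x \<in> S" "z \<in> S" "z \<noteq> x"
  obtains y where "y \<in> S" "y \<noteq> x" "card {w \<in> S. {y, w} \<in> edges T} \<le> 1"
proof (rule ccontr)
  assume "\<not> thesis"
  with that have deg: "1 < card {w \<in> S. {y, w} \<in> edges T}" if "y \<in> S" "y \<noteq> x" for y
    using \<open>y \<in> S\<close> \<open>y \<noteq> x\<close> by force
  have fin: "finite S" and ed: "edges T \<subseteq> [verts T]\<^bsup>2\<^esup>"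
    using assms(1,2) by (auto simp: forest_def fin_graph_def intro: finite_subset)
  have noloop: "{v, v} \<notin> edges T" for v
    using ed by (auto simp: nsets_def)
  have two: "\<exists>b\<in>S. b \<noteq> w \<and> {y, b} \<in> edges T" if "y \<in> S" "y \<noteq> x" for y w
  proof (rule ccontr)
    assume "\<not> ?thesis"
    then have "{w \<in> S. {y, w} \<in> edges T} \<subseteq> {w}" by auto
    then have "card {w \<in> S. {y, w} \<in> edges T} \<le> 1"
      using card_mono[of "{w}"] by fastforce
    with deg[OF that] show False by simp
  qed
  define P where "P xs \<longleftrightarrow> distinct xs \<and> set xs \<subseteq> S \<and>
    (\<forall>i. Suc i < length xs \<longrightarrow> {xs ! i, xs ! Suc i} \<in> edges T)" for xs
  have bound: "length xs \<le> card S" if "P xs" for xs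
    using that fin unfolding P_def by (metis card_mono distinct_card)
  obtain w where w: "w \<in> S" "{z, w} \<in> edges T"
    using two[OF assms(4,5)] by blast
  have P0: "P [z, w]"
    using w assms(4) noloop by (auto simp: P_def)
  obtain xs where xs: "P xs" "\<And>ys. P ys \<Longrightarrow> length ys \<le> length xs"
    using ex_has_greatest_nat[of P "[z, w]" length "card S + 1"] P0 bound
    by (metis less_Suc_eq_le Suc_eq_plus1)
  have len: "2 \<le> length xs"
    using xs(2)[OF P0] by simp
  have Prev: "P (rev ys)" if "P ys" for ys
    unfolding P_def
  proof (intro conjI allI impI)
    show "distinct (rev ys)" "set (rev ys) \<subseteq> S" using that by (auto simp: P_def)
    fix i assume i: "Suc i < length (rev ys)"
    define j where "j = length ys - Suc (Suc i)"
    have "Suc j < length ys" "rev ys ! i = ys ! Suc j" "rev ys ! Suc i = ys ! j"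
      using i by (auto simp: j_def rev_nth Suc_diff_Suc)
    then show "{rev ys ! i, rev ys ! Suc i} \<in> edges T"
      using that by (metis P_def insert_commute)
  qed
  have "hd xs \<noteq> last xs"
    using len xs(1) unfolding P_def
    by (cases xs) (auto simp: Suc_le_eq)
  then obtain ys where ys: "P ys" "length ys = length xs" "ys ! 0 \<noteq> x"
  proof (cases "hd xs = x")
    case True
    with \<open>hd xs \<noteq> last xs\<close> have "rev xs ! 0 \<noteq> x"
      using len by (metis hd_conv_nth hd_rev length_0_conv length_rev not_numeral_le_zero)
    then show ?thesis using that[of "rev xs"] Prev[OF xs(1)] by simp
  next
    case False
    then have "xs ! 0 \<noteq> x" using len by (metis hd_conv_nth length_0_conv not_numeral_le_zero)
    then show ?thesis using that[of xs] xs(1) by simp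
  qed
  have "0 < length ys" using ys len by linarith
  from nth_mem[OF this] have y0: "ys ! 0 \<in> S"
    using ys(1) unfolding P_def by blast
  obtain b where b: "b \<in> S" "b \<noteq> ys ! 1" "{ys ! 0, b} \<in> edges T"
    using two[OF y0 ys(3)] by blast
  have "b \<in> set ys"
  proof (rule ccontr)
    assume nb: "b \<notin> set ys"
    have "P (b # ys)"
      unfolding P_def
    proof (intro conjI allI impI)
      show "distinct (b # ys)" "set (b # ys) \<subseteq> S" using nb ys(1) b(1) by (auto simp: P_def)
      fix i assume "Suc i < length (b # ys)"
      then show "{(b # ys) ! i, (b # ys) ! Suc i} \<in> edges T"
        using ys(1) b(3) by (cases i) (auto simp: P_def insert_commute)
    qed
    from xs(2)[OF this] ys(2) show False by simp
  qed
  then obtain j where j: "j < length ys" "b = ys ! j" by (auto simp: in_set_conv_nth)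
  \<comment> \<open>\<open>j = 0\<close> would be a loop and \<open>j = 1\<close> is the neighbour
    excluded by the choice of \<open>b\<close>, so the closed path has at least three
    vertices.\<close>
  have "j \<noteq> 0" "j \<noteq> 1" using b noloop j by (metis, metis)
  then have j2: "2 \<le> j" by simp
  have "is_cycle T (take (Suc j) ys)"
    unfolding is_cycle_def
  proof (intro conjI allI impI)
    show "3 \<le> length (take (Suc j) ys)" using j j2 by simp
    show "distinct (take (Suc j) ys)" using ys(1) by (simp add: P_def)
    fix i assume "i < length (take (Suc j) ys)"
    then have i: "i < Suc j" using j by simp
    have l: "length (take (Suc j) ys) = Suc j" using j by simp
    show "{take (Suc j) ys ! i, take (Suc j) ys ! (Suc i mod length (take (Suc j) ys))} \<in> edges T"
    proof (cases "i = j")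
      case True
      then show ?thesis using b(3) j by (simp add: l insert_commute)
    next
      case False
      then have "Suc i < Suc j" using i by simp
      then show ?thesis using ys(1) j i by (simp add: l P_def)
    qed
  qed
  then show False using assms(1) by (simp add: forest_def)
qed

text \<open>Among the non-isolated vertices \<open>S\<close>, a vertex with at most one neighbour
  has exactly one.\<close>

lemma forest_leaf:
  assumes "forest T" "edges T \<noteq> {}"
  obtains x y where "x \<in> verts T" "y \<in> verts T" "x \<noteq> y" "{x, y} \<in> edges T"
    "\<And>w. {w, y} \<in> edges T \<Longrightarrow> w = x"
proof -
  define S where "S = {v \<in> verts T. \<exists>w. {v, w} \<in> edges T}"
  have ed: "edges T \<subseteq> [verts T]\<^bsup>2\<^esup>" and fin: "finite (verts T)"
    using assms(1) by (auto simp: forest_def fin_graph_def)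
  have ends: "a \<in> verts T \<and> b \<in> verts T \<and> a \<noteq> b" if "{a, b} \<in> edges T" for a b
    using that ed by (auto simp: nsets_def card_insert_if split: if_splits)
  obtain e where "e \<in> edges T" using assms(2) by blast
  moreover from this have "card e = 2" using ed by (auto simp: nsets_def)
  ultimately obtain a b where ab: "{a, b} \<in> edges T" by (metis card_2_iff)
  then have "a \<in> S" "b \<in> S" "b \<noteq> a"
    using ends[OF ab] by (auto simp: S_def insert_commute)
  then obtain y where y: "y \<in> S" "card {w \<in> S. {y, w} \<in> edges T} \<le> 1"
    using forest_low_degree_vertex[OF assms(1), of S a b] by (auto simp: S_def)
  obtain x where x: "{y, x} \<in> edges T" using y by (auto simp: S_def)
  have nb: "w \<in> {w \<in> S. {y, w} \<in> edges T}" if "{y, w} \<in> edges T" for w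
    using that ends[OF that] by (auto simp: S_def insert_commute)
  have finS: "finite {w \<in> S. {y, w} \<in> edges T}" using fin by (simp add: S_def)
  have "w = x" if "{w, y} \<in> edges T" for w
  proof (rule ccontr)
    assume "w \<noteq> x"
    have "{w, x} \<subseteq> {w \<in> S. {y, w} \<in> edges T}"
      using nb[OF x] nb[of w] that by (auto simp: insert_commute)
    from card_mono[OF finS this] \<open>w \<noteq> x\<close> y(2) show False by simp
  qed
  then show ?thesis using that[of x y] x ends[OF x] by (metis insert_commute)
qed

subsection \<open>Cores\<close>

definition nbrs :: "'a set set \<Rightarrow> 'a set \<Rightarrow> 'a \<Rightarrow> 'a set" where
  "nbrs F W v = {u \<in> W. {v, u} \<in> F}"

text \<open>The \<open>d\<close>-core of the graph. Taking the union of all sets of inner minimum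
  degree \<open>d\<close> avoids a deletion process; the union has the same property because degrees
  only grow with the set.\<close>

definition core :: "nat \<Rightarrow> 'a set set \<Rightarrow> 'a set \<Rightarrow> 'a set" where
  "core d F V = \<Union>{W. W \<subseteq> V \<and> (\<forall>v\<in>W. d \<le> card (nbrs F W v))}"

lemma nbrs_mono: "W \<subseteq> W' \<Longrightarrow> nbrs F W v \<subseteq> nbrs F W' v"
  by (auto simp: nbrs_def)

lemma finite_nbrs: "finite W \<Longrightarrow> finite (nbrs F W v)"
  by (simp add: nbrs_def)

lemma core_subset: "core d F V \<subseteq> V"
  by (auto simp: core_def)

lemma core_degree:
  assumes "finite V" "v \<in> core d F V"
  shows "d \<le> card (nbrs F (core d F V) v)"
proof -
  obtain W where W: "W \<subseteq> V" "\<forall>v\<in>W. d \<le> card (nbrs F W v)" "v \<in> W"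
    using assms(2) by (auto simp: core_def)
  then have "nbrs F W v \<subseteq> nbrs F (core d F V) v"
    by (intro nbrs_mono) (auto simp: core_def)
  moreover have "finite (nbrs F (core d F V) v)"
    using assms(1) core_subset by (metis finite_nbrs finite_subset)
  ultimately show ?thesis
    using W by (meson card_mono le_trans)
qed

lemma core_greatest:
  assumes "W \<subseteq> V" "\<And>v. v \<in> W \<Longrightarrow> d \<le> card (nbrs F W v)"
  shows "W \<subseteq> core d F V"
  using assms by (auto simp: core_def)

text \<open>Vertices of \<open>Y\<close> are deleted one at a time. While \<open>Y\<close> is not
  inside the core, maximality of the core yields a vertex with fewer than \<open>d\<close>
  neighbours in the union of \<open>Y\<close> and the core. It cannot be a core vertex, so it lies
  in \<open>Y\<close>, and deleting it loses at most \<open>d\<close> edges.\<close>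

lemma card_edges_outside_core:
  assumes "finite V" "F \<subseteq> [V]\<^bsup>2\<^esup>" "Y \<subseteq> V"
  shows "card {e \<in> F. e \<subseteq> Y \<and> \<not> e \<subseteq> core d F V} \<le> d * card Y"
  using assms(3)
proof (induction "card Y" arbitrary: Y)
  case 0
  then have "Y = {}" using assms(1) by (metis card_0_eq finite_subset)
  then show ?case using assms(2) by (auto simp: nsets_def)
next
  case (Suc m)
  let ?P = "core d F V"
  have finY: "finite Y" using Suc.prems assms(1) by (rule finite_subset)
  have finP: "finite ?P" using core_subset assms(1) by (rule finite_subset)
  have finF: "finite F" using assms(1,2) by (meson finite_imp_finite_nsets finite_subset)
  show ?case
  proof (cases "Y \<subseteq> ?P")
    case True
    then have "{e \<in> F. e \<subseteq> Y \<and> \<not> e \<subseteq> ?P} = {}" by auto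
    then show ?thesis by (metis card.empty le0)
  next
    case False
    then have "\<not> ?P \<union> Y \<subseteq> ?P" by simp
    moreover have "?P \<union> Y \<subseteq> V" using Suc.prems core_subset by (metis Un_least)
    ultimately obtain y where y: "y \<in> ?P \<union> Y" "card (nbrs F (?P \<union> Y) y) < d"
      using core_greatest[of "?P \<union> Y" V d F] by (meson not_le)
    have yP: "y \<notin> ?P"
    proof
      assume "y \<in> ?P"
      from core_degree[OF assms(1) this]
      have "d \<le> card (nbrs F ?P y)" .
      also have "\<dots> \<le> card (nbrs F (?P \<union> Y) y)"
        by (intro card_mono finite_nbrs nbrs_mono) (use finP finY in auto)
      finally show False using y(2) by simp
    qed
    with y have yY: "y \<in> Y" by simp
    have "card {e \<in> F. e \<subseteq> Y \<and> \<not> e \<subseteq> ?P}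
        \<le> card ({e \<in> F. e \<subseteq> Y - {y} \<and> \<not> e \<subseteq> ?P} \<union> (\<lambda>u. {y, u}) ` nbrs F Y y)"
    proof (rule card_mono)
      show "finite ({e \<in> F. e \<subseteq> Y - {y} \<and> \<not> e \<subseteq> ?P} \<union> (\<lambda>u. {y, u}) ` nbrs F Y y)"
        using finF finY by (simp add: finite_nbrs)
      show "{e \<in> F. e \<subseteq> Y \<and> \<not> e \<subseteq> ?P}
          \<subseteq> {e \<in> F. e \<subseteq> Y - {y} \<and> \<not> e \<subseteq> ?P} \<union> (\<lambda>u. {y, u}) ` nbrs F Y y"
      proof
        fix e assume e: "e \<in> {e \<in> F. e \<subseteq> Y \<and> \<not> e \<subseteq> ?P}"
        show "e \<in> {e \<in> F. e \<subseteq> Y - {y} \<and> \<not> e \<subseteq> ?P} \<union> (\<lambda>u. {y, u}) ` nbrs F Y y"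
        proof (cases "y \<in> e")
          case True
          have "card e = 2" using e assms(2) by (auto simp: nsets_def)
          with True obtain u where "e = {y, u}" by (auto simp: card_2_iff)
          then show ?thesis using e by (auto simp: nbrs_def)
        next
          case False
          then show ?thesis using e by auto
        qed
      qed
    qed
    also have "\<dots> \<le> card {e \<in> F. e \<subseteq> Y - {y} \<and> \<not> e \<subseteq> ?P} + card (nbrs F Y y)"
      by (rule order_trans[OF card_Un_le]) (simp add: card_image_le finite_nbrs finY)
    also have "\<dots> \<le> d * card (Y - {y}) + d"
    proof (rule add_mono)
      show "card {e \<in> F. e \<subseteq> Y - {y} \<and> \<not> e \<subseteq> ?P} \<le> d * card (Y - {y})"
        using Suc yY finY by (intro Suc.hyps(1)) auto
      have "card (nbrs F Y y) \<le> card (nbrs F (?P \<union> Y) y)"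
        by (intro card_mono finite_nbrs nbrs_mono) (use finP finY in auto)
      then show "card (nbrs F Y y) \<le> d" using y(2) by simp
    qed
    also have "\<dots> = d * card Y"
      using yY Suc.hyps(2)[symmetric] by (simp add: card_Diff_singleton)
    finally show ?thesis .
  qed
qed

section \<open>Greedy embedding of forests into graphs of large minimum degree\<close>

text \<open>Induction on the part \<open>S\<close> of the forest: remove a vertex \<open>y\<close>
  other than \<open>x\<close> with at most one neighbour in \<open>S\<close>, embed the rest, and
  place \<open>y\<close> on a neighbour of the image of its own neighbour that is neither used nor
  in \<open>A\<close>. The set \<open>A\<close> reserves vertices for a later extension.\<close>

lemma forest_embedding:
  assumes "forest T" "finite W" "\<And>v. v \<in> W \<Longrightarrow> d \<le> card (nbrs F W v)"
    and "u \<in> W" "u \<notin> A" "finite A" "S \<subseteq> verts T" "x \<in> S" "card S + card A \<le> d"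
  shows "\<exists>f. inj_on f S \<and> f x = u \<and> f ` S \<subseteq> W - A \<and>
    (\<forall>a\<in>S. \<forall>b\<in>S. {a, b} \<in> edges T \<longrightarrow> {f a, f b} \<in> F)"
proof -
  have ed: "edges T \<subseteq> [verts T]\<^bsup>2\<^esup>" and fin: "finite (verts T)"
    using assms(1) by (auto simp: forest_def fin_graph_def)
  have noloop: "{v, v} \<notin> edges T" for v using ed by (auto simp: nsets_def)
  show ?thesis
    using assms(7-9)
  proof (induction "card S" arbitrary: S)
    case 0
    then show ?case using fin by (metis card_0_eq empty_iff finite_subset)
  next
    case (Suc m)
    have finS: "finite S" using Suc.prems fin by (metis finite_subset)
    show ?case
    proof (cases "S = {x}")
      case True
      then show ?thesis
        using assms(4,5) noloop by (intro exI[of _ "\<lambda>_. u"]) auto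
    next
      case False
      then obtain z where "z \<in> S" "z \<noteq> x" using Suc.prems by blast
      then obtain y where y: "y \<in> S" "y \<noteq> x" "card {w \<in> S. {y, w} \<in> edges T} \<le> 1"
        using forest_low_degree_vertex[OF assms(1) Suc.prems(1,2)] by blast
      let ?S = "S - {y}"
      have cS: "card S = Suc (card ?S)" using y(1) finS by (metis card_Suc_Diff1)
      have "\<exists>f. inj_on f ?S \<and> f x = u \<and> f ` ?S \<subseteq> W - A \<and>
        (\<forall>a\<in>?S. \<forall>b\<in>?S. {a, b} \<in> edges T \<longrightarrow> {f a, f b} \<in> F)"
      proof (rule Suc.hyps(1))
        show "m = card ?S" using Suc.hyps(2) cS by linarith
        show "?S \<subseteq> verts T" "x \<in> ?S" using Suc.prems(1,2) y(2) by blast+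
        show "card ?S + card A \<le> d" using Suc.prems(3) cS by linarith
      qed
      then obtain f where f: "inj_on f ?S" "f x = u" "f ` ?S \<subseteq> W - A"
        "\<forall>a\<in>?S. \<forall>b\<in>?S. {a, b} \<in> edges T \<longrightarrow> {f a, f b} \<in> F" by blast
      \<comment> \<open>If \<open>y\<close> has no neighbour in \<open>S\<close>, any anchor serves,
        and \<open>x\<close> is taken.\<close>
      obtain p where p: "p \<in> ?S" "\<And>w. w \<in> S \<Longrightarrow> {y, w} \<in> edges T \<Longrightarrow> w = p"
      proof (cases "{w \<in> S. {y, w} \<in> edges T} = {}")
        case True
        then show ?thesis
          by (intro that[of x]) (use Suc.prems(2) y(2) in blast)+
      next
        case False
        then have "card {w \<in> S. {y, w} \<in> edges T} \<noteq> 0"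
          using finS by (subst card_0_eq) simp_all
        then have "card {w \<in> S. {y, w} \<in> edges T} = 1"
          using y(3) by linarith
        then obtain p where "{w \<in> S. {y, w} \<in> edges T} = {p}" by (metis card_1_singletonE)
        then show ?thesis
          using noloop[of y] by (intro that[of p]) blast+
      qed
      have fp: "f p \<in> W" using f(3) p(1) by auto
      \<comment> \<open>The degree bound beats the number of occupied and forbidden vertices,
        because \<open>y\<close> itself has not been placed yet.\<close>
      have "card (f ` ?S \<union> A) < card (nbrs F W (f p))"
      proof -
        have "card (f ` ?S \<union> A) \<le> card ?S + card A"
          by (rule order_trans[OF card_Un_le]) (simp add: card_image_le finS)
        also have "\<dots> < d" using Suc.prems(3) cS by simp
        also have "\<dots> \<le> card (nbrs F W (f p))" by (rule assms(3)[OF fp])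
        finally show ?thesis .
      qed
      then have "\<not> nbrs F W (f p) \<subseteq> f ` ?S \<union> A"
        using card_mono[of "f ` ?S \<union> A" "nbrs F W (f p)"] finS assms(6) by auto
      then obtain q where q: "q \<in> W" "{f p, q} \<in> F" "q \<notin> f ` ?S" "q \<notin> A"
        by (auto simp: nbrs_def)
      let ?f = "f(y := q)"
      have "inj_on ?f (insert y ?S)"
        using f(1) q(3) by (auto simp: inj_on_def)
      then have "inj_on ?f S" using y(1) by (simp add: insert_absorb)
      moreover have "?f x = u" using f(2) y(2) by simp
      moreover have "?f ` S \<subseteq> W - A" using f(3) q by auto
      moreover have "{?f a, ?f b} \<in> F" if "a \<in> S" "b \<in> S" "{a, b} \<in> edges T" for a b
      proof (cases "a = y")
        case True
        then have "b = p" using p(2) that by blast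
        then show ?thesis using True q(2) p(1) by (simp add: insert_commute)
      next
        case False
        show ?thesis
        proof (cases "b = y")
          case True
          then have "a = p" using p(2) that by (metis insert_commute)
          then show ?thesis using True q(2) p(1) by simp
        next
          case False
          then show ?thesis using f(4) that \<open>a \<noteq> y\<close> by simp
        qed
      qed
      ultimately show ?thesis by blast
    qed
  qed
qed

text \<open>Embed \<open>T\<close> without a leaf \<open>y\<close> into the core, sending the
  neighbour \<open>x\<close> of the leaf to \<open>u\<close> and avoiding \<open>v\<close>; then
  send \<open>y\<close> to \<open>v\<close>. Thus only one end of the edge has to lie in the
  core.\<close>

lemma forest_copy_through_core_edge:
  assumes "forest T" "edges T \<noteq> {}" "card (verts T) \<le> d"
    and "finite V" "u \<in> core d F V" "v \<in> V" "u \<noteq> v" "{u, v} \<in> F"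
  shows "\<exists>H \<in> copies T (V, F). {u, v} \<in> edges H"
proof -
  have ed: "edges T \<subseteq> [verts T]\<^bsup>2\<^esup>" and fin: "finite (verts T)"
    using assms(1) by (auto simp: forest_def fin_graph_def)
  have noloop: "{v, v} \<notin> edges T" for v using ed by (auto simp: nsets_def)
  obtain x y where xy: "x \<in> verts T" "y \<in> verts T" "x \<noteq> y" "{x, y} \<in> edges T"
    "\<And>w. {w, y} \<in> edges T \<Longrightarrow> w = x"
    using forest_leaf[OF assms(1,2)] by metis
  let ?S = "verts T - {y}"
  \<comment> \<open>The removed leaf makes up for the forbidden vertex \<open>v\<close>.\<close>
  have c: "card ?S + card {v} \<le> d"
    using assms(3) card_Suc_Diff1[OF fin xy(2)] by simp
  have finP: "finite (core d F V)" using core_subset assms(4) by (rule finite_subset)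
  have deg: "d \<le> card (nbrs F (core d F V) w)" if "w \<in> core d F V" for w
    using core_degree[OF assms(4) that] .
  have S: "?S \<subseteq> verts T" "x \<in> ?S" and av: "u \<notin> {v}"
    using assms(7) xy(1-3) by auto
  have "finite {v}" by simp
  note emb = forest_embedding[OF assms(1) finP deg assms(5) av this S c]
  obtain f where f: "inj_on f ?S" "f x = u" "f ` ?S \<subseteq> core d F V - {v}"
    "\<forall>a\<in>?S. \<forall>b\<in>?S. {a, b} \<in> edges T \<longrightarrow> {f a, f b} \<in> F"
    using emb by blast
  let ?f = "f(y := v)"
  have inj: "inj_on ?f (verts T)"
  proof -
    have "inj_on ?f (insert y ?S)"
      using f(1,3) by (auto simp: inj_on_def)
    then show ?thesis using xy(2) by (simp add: insert_absorb)
  qed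
  have img: "?f ` verts T \<subseteq> V"
    using f(3) core_subset[of d F V] assms(6) by auto
  have "?f ` e \<in> F" if "e \<in> edges T" for e
  proof -
    have e2: "card e = 2" "e \<subseteq> verts T" using that ed by (auto simp: nsets_def)
    then obtain a b where ab: "e = {a, b}" by (metis card_2_iff)
    show ?thesis
    proof (cases "a = y \<or> b = y")
      case True
      \<comment> \<open>The only edge of \<open>T\<close> at the leaf \<open>y\<close> is the one
        mapped to the prescribed edge.\<close>
      then have "e = {x, y}" using xy(5) that ab by (metis insert_commute)
      then have "?f ` e = {u, v}" using f(2) xy(3) by simp
      then show ?thesis using assms(8) by simp
    next
      case False
      then have "a \<in> ?S" "b \<in> ?S" using e2(2) ab by auto
      then have "{f a, f b} \<in> F" using f(4) that ab by blast
      moreover have "?f ` e = {f a, f b}" using False ab by simp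
      ultimately show ?thesis by simp
    qed
  qed
  then have "(?f ` verts T, (`) ?f ` edges T) \<in> copies T (V, F)"
    by (intro copiesI inj img)
  moreover have "{u, v} \<in> (`) ?f ` edges T"
    using xy(1-4) f(2) by (intro image_eqI[of _ _ "{x, y}"]) auto
  ultimately show ?thesis by (metis snd_conv)
qed

text \<open>In a \<open>T\<close>-free graph no edge lies inside the core, so all edges are counted
  by \<open>card_edges_outside_core\<close> with \<open>Y = V\<close>.\<close>

lemma card_copies_free_le:
  assumes "forest T" "edges T \<noteq> {}" "finite V" "F \<subseteq> [V]\<^bsup>2\<^esup>" "copies T (V, F) = {}"
  shows "card F \<le> card (verts T) * card V"
proof -
  let ?P = "core (card (verts T)) F V"
  have "\<not> e \<subseteq> ?P" if "e \<in> F" for e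
  proof
    assume e: "e \<subseteq> ?P"
    from that assms(4) have "e \<in> [V]\<^bsup>2\<^esup>" by blast
    then obtain u v where uv: "e = {u, v}" "v \<in> V" "u \<noteq> v" by (rule nsets2_E)
    have "\<exists>H \<in> copies T (V, F). {u, v} \<in> edges H"
      by (rule forest_copy_through_core_edge[OF assms(1,2) order_refl assms(3)])
        (use uv e that in auto)
    then show False using assms(5) by blast
  qed
  then have "{e \<in> F. e \<subseteq> V \<and> \<not> e \<subseteq> ?P} = F"
    using assms(4) unfolding nsets_def by blast
  then show ?thesis
    using card_edges_outside_core[OF assms(3,4) order_refl, of "card (verts T)"] by simp
qed

lemma ex_num_le:
  assumes "forest T" "edges T \<noteq> {}"
  shows "ex_num n T \<le> card (verts T) * n"
proof -
  obtain F where "F \<subseteq> [{..<n}]\<^bsup>2\<^esup>" "copies T ({..<n}, F) = {}" "card F = ex_num n T"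
    using ex_num_attained[OF assms(2)] .
  then show ?thesis
    using card_copies_free_le[OF assms, of "{..<n}" F] by simp
qed

subsection \<open>NIM-edges avoid the cores\<close>

lemma copies_edges_subset: "H \<in> copies T (V, F) \<Longrightarrow> edges H \<subseteq> F"
  unfolding copies_def by auto

lemma copies_restrict: "H \<in> copies T (V, F) \<Longrightarrow> edges H \<subseteq> F' \<Longrightarrow> H \<in> copies T (V, F')"
  unfolding copies_def by fastforce

lemma copies_mono: "H \<in> copies T (V, F) \<Longrightarrow> F \<subseteq> F' \<Longrightarrow> H \<in> copies T (V, F')"
  using copies_restrict copies_edges_subset by (meson order_trans)

definition colour_class :: "nat \<Rightarrow> (nat set \<Rightarrow> nat) \<Rightarrow> nat \<Rightarrow> nat set set" where
  "colour_class n c l = {e \<in> [{..<n}]\<^bsup>2\<^esup>. c e = l}"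

lemma nim_edges_subset: "nim_edges n c T \<subseteq> [{..<n}]\<^bsup>2\<^esup>"
  by (auto simp: nim_edges_def complete_graph_def)

lemma mono_copy_not_nim:
  assumes "H \<in> copies T ({..<n}, colour_class n c l)" "e \<in> edges H"
  shows "e \<notin> nim_edges n c T"
proof -
  have "H \<in> copies T (complete_graph n)"
    unfolding complete_graph_def
    by (rule copies_mono[OF assms(1)]) (auto simp: colour_class_def)
  moreover have "\<forall>e'\<in>edges H. c e' = l"
    using copies_edges_subset[OF assms(1)] by (auto simp: colour_class_def)
  ultimately show ?thesis
    using assms(2) unfolding nim_edges_def by blast
qed

text \<open>Such a copy would be monochromatic and, as \<open>T\<close> has an edge, would contain a
  NIM-edge.\<close>

lemma copies_nim_class_empty:
  assumes "edges T \<noteq> {}"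
  shows "copies T ({..<n}, {e \<in> nim_edges n c T. c e = l}) = {}"
proof (rule ccontr)
  assume "copies T ({..<n}, {e \<in> nim_edges n c T. c e = l}) \<noteq> {}"
  then obtain H where H: "H \<in> copies T ({..<n}, {e \<in> nim_edges n c T. c e = l})" by blast
  have "H \<in> copies T ({..<n}, colour_class n c l)"
    by (rule copies_mono[OF H]) (use nim_edges_subset[of n c T] in \<open>auto simp: colour_class_def\<close>)
  moreover have "edges H \<noteq> {}"
    using H assms by (auto simp: copies_def)
  moreover have "edges H \<subseteq> nim_edges n c T"
    using copies_edges_subset[OF H] by blast
  ultimately show False using mono_copy_not_nim by blast
qed

text \<open>An edge meeting the core of its own colour is the pendant edge of a copy in that
  colour.\<close>

lemma nim_class_avoids_core:
  assumes "forest T" "edges T \<noteq> {}" "e \<in> nim_edges n c T" "c e = l"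
  shows "e \<inter> core (card (verts T)) (colour_class n c l) {..<n} = {}"
proof (rule ccontr)
  assume "e \<inter> core (card (verts T)) (colour_class n c l) {..<n} \<noteq> {}"
  then obtain u where u: "u \<in> e" "u \<in> core (card (verts T)) (colour_class n c l) {..<n}"
    by blast
  have e: "e \<in> [{..<n}]\<^bsup>2\<^esup>" using assms(3) nim_edges_subset by blast
  then obtain v where v: "e = {u, v}" "u \<noteq> v" "v \<in> {..<n}"
    using u(1) by (elim nsets2_E) blast
  have "\<exists>H \<in> copies T ({..<n}, colour_class n c l). {u, v} \<in> edges H"
    by (rule forest_copy_through_core_edge[OF assms(1,2) order_refl _ u(2)])
      (use e v assms(4) in \<open>simp_all add: colour_class_def\<close>)
  then show False using mono_copy_not_nim assms(3) v(1) by blast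
qed

subsection \<open>Upper bound\<close>

text \<open>Every pair between \<open>X\<close> and \<open>Y\<close> leaves the core of its own
  colour, and each colour has only linearly many such edges. Large \<open>X\<close> and
  \<open>Y\<close> would span quadratically many pairs.\<close>

lemma coreless_pair_small:
  assumes "finite V" "[V]\<^bsup>2\<^esup> = (\<Union>l<k. F l)" "X \<subseteq> V" "Y \<subseteq> V"
    and "\<And>l. l < k \<Longrightarrow> X \<inter> core h (F l) V = {} \<or> Y \<inter> core h (F l) V = {}"
  shows "card X < 4 * k * h + 2 \<or> card Y < 4 * k * h + 2"
proof (rule ccontr)
  \<comment> \<open>The size \<open>b\<close> is just large enough for
    \<open>2 * k * h * b < b * b\<close>. The threshold in the claim is \<open>2 * b\<close> since
    \<open>X\<close> and \<open>Y\<close> may overlap: \<open>b\<close> elements of \<open>Y\<close>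
    must remain after \<open>X'\<close> is removed.\<close>
  define b where "b = 2 * k * h + 1"
  assume "\<not> ?thesis"
  then have big: "2 * b \<le> card X" "2 * b \<le> card Y" by (auto simp: b_def)
  have "b \<le> card X" using big by simp
  then obtain X' where X': "X' \<subseteq> X" "card X' = b" "finite X'"
    by (rule obtain_subset_with_card_n)
  have "b \<le> card (Y - X')"
    using diff_card_le_card_Diff[OF X'(3), of Y] X'(2) big by linarith
  then obtain Y' where Y': "Y' \<subseteq> Y - X'" "card Y' = b" "finite Y'"
    by (rule obtain_subset_with_card_n)
  let ?D = "\<lambda>l. {e \<in> F l. e \<subseteq> X' \<union> Y' \<and> \<not> e \<subseteq> core h (F l) V}"
  have Fl: "F l \<subseteq> [V]\<^bsup>2\<^esup>" if "l < k" for l using assms(2) that by blast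
  have XYV: "X' \<union> Y' \<subseteq> V" using X' Y' assms(3,4) by blast
  have "inj_on (\<lambda>(x, y). {x, y}) (X' \<times> Y')"
    using Y'(1) by (auto simp: inj_on_def doubleton_eq_iff)
  then have "b * b = card ((\<lambda>(x, y). {x, y}) ` (X' \<times> Y'))"
    using X' Y' by (simp add: card_image card_cartesian_product)
  also have "\<dots> \<le> card (\<Union>l<k. ?D l)"
  proof (rule card_mono)
    have "finite (F l)" if "l < k" for l
      using Fl[OF that] assms(1) by (meson finite_imp_finite_nsets finite_subset)
    then show "finite (\<Union>l<k. ?D l)" by auto
    show "(\<lambda>(x, y). {x, y}) ` (X' \<times> Y') \<subseteq> (\<Union>l<k. ?D l)"
    proof (rule image_subsetI)
      fix q assume "q \<in> X' \<times> Y'"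
      then obtain x y where q: "q = (x, y)" "x \<in> X'" "y \<in> Y'" by blast
      then have "{x, y} \<in> [V]\<^bsup>2\<^esup>" using XYV Y'(1) by auto
      then obtain l where l: "l < k" "{x, y} \<in> F l" using assms(2) by blast
      \<comment> \<open>Otherwise \<open>x\<close> and \<open>y\<close> would witness that
        \<open>X\<close> and \<open>Y\<close> both meet this core.\<close>
      have "\<not> {x, y} \<subseteq> core h (F l) V"
        using assms(5)[OF l(1)] q X'(1) Y'(1) by blast
      then show "(case q of (x, y) \<Rightarrow> {x, y}) \<in> (\<Union>l<k. ?D l)"
        using l q by auto
    qed
  qed
  also have "\<dots> \<le> (\<Sum>l<k. card (?D l))"
    by (rule card_UN_le) simp
  also have "\<dots> \<le> (\<Sum>l<k. h * card (X' \<union> Y'))"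
    by (intro sum_mono card_edges_outside_core assms(1) Fl XYV) simp
  also have "\<dots> \<le> k * (h * (2 * b))"
    using card_Un_le[of X' Y'] X'(2) Y'(2) by simp
  also have "\<dots> = b * (2 * k * h)" by simp
  also have "\<dots> < b * b" by (simp add: b_def)
  finally show False by simp
qed

text \<open>Double counting of incidences. A vertex outside the exceptional set \<open>X\<close>
  misses at least two of the sets \<open>N l\<close>; the at most \<open>k * b\<close> vertices of
  \<open>X\<close> count at most \<open>k\<close> times each.\<close>

lemma sum_card_le:
  fixes N :: "nat \<Rightarrow> 'a set"
  assumes "finite V" "2 \<le> k" "\<And>l. l < k \<Longrightarrow> N l \<subseteq> V"
    and "\<And>i. i < k \<Longrightarrow> card {v \<in> V. \<forall>l<k. l \<noteq> i \<longrightarrow> v \<in> N l} \<le> b"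
  shows "(\<Sum>l<k. card (N l)) \<le> (k - 2) * card V + k * (k * b)"
proof -
  define X where "X = (\<Union>i<k. {v \<in> V. \<forall>l<k. l \<noteq> i \<longrightarrow> v \<in> N l})"
  have X: "X \<subseteq> V" "finite X" using assms(1) by (auto simp: X_def intro: finite_subset)
  have cX: "card X \<le> k * b"
  proof -
    have "card X \<le> (\<Sum>i<k. card {v \<in> V. \<forall>l<k. l \<noteq> i \<longrightarrow> v \<in> N l})"
      unfolding X_def by (rule card_UN_le) simp
    also have "\<dots> \<le> (\<Sum>i<k. b)" by (intro sum_mono assms(4)) simp
    finally show ?thesis by simp
  qed
  let ?m = "\<lambda>v. card {l \<in> {..<k}. v \<in> N l}"
  have "card (N l) = (\<Sum>v\<in>V. if v \<in> N l then 1 else 0)" if "l < k" for l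
    using assms(1) assms(3)[OF that] by (simp add: sum.If_cases Int_absorb1)
  then have "(\<Sum>l<k. card (N l)) = (\<Sum>l<k. \<Sum>v\<in>V. if v \<in> N l then 1 else 0)" by simp
  also have "\<dots> = (\<Sum>v\<in>V. \<Sum>l<k. if v \<in> N l then 1 else 0)" by (rule sum.swap)
  also have "\<dots> = (\<Sum>v\<in>V. ?m v)"
    by (simp add: sum.If_cases Int_def)
  also have "\<dots> = (\<Sum>v\<in>V - X. ?m v) + (\<Sum>v\<in>X. ?m v)"
    by (rule sum.subset_diff[OF X(1) assms(1)])
  also have "\<dots> \<le> (\<Sum>v\<in>V - X. k - 2) + (\<Sum>v\<in>X. k)"
  proof (intro add_mono sum_mono)
    fix v
    have "?m v \<le> card {..<k}" by (intro card_mono) auto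
    then show "?m v \<le> k" by simp
  next
    fix v assume v: "v \<in> V - X"
    have nX: "\<not> {l \<in> {..<k}. v \<notin> N l} \<subseteq> {i}" if "i < k" for i
      using v that unfolding X_def by blast
    \<comment> \<open>The first index only provides some missed set; using that set as the
      exceptional index provides a second one.\<close>
    obtain a where a: "a < k" "v \<notin> N a" using nX[of 0] assms(2) by auto
    obtain a' where a': "a' < k" "v \<notin> N a'" "a' \<noteq> a" using nX[OF a(1)] by auto
    have "{l \<in> {..<k}. v \<in> N l} \<subseteq> {..<k} - {a, a'}" using a a' by auto
    then have "?m v \<le> card ({..<k} - {a, a'})" by (intro card_mono) auto
    also have "\<dots> = k - 2" using a a' by (subst card_Diff_subset) auto
    finally show "?m v \<le> k - 2" .
  qed
  also have "\<dots> = (k - 2) * card (V - X) + k * card X" by simp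
  also have "\<dots> \<le> (k - 2) * card V + k * (k * b)"
    by (intro add_mono mult_le_mono le_refl cX card_mono assms(1)) auto
  finally show ?thesis .
qed

text \<open>The number \<open>p\<close> carries all information about the density of the Turan
  number, so the case \<open>k = 2\<close> and the case of trees can share one argument.\<close>

lemma card_nim_edges_le:
  fixes p :: real
  assumes T: "forest T" "edges T \<noteq> {}" "card (verts T) = h"
    and k: "2 \<le> k" and c: "c \<in> edge_colourings k n"
    and p: "0 \<le> p" "p \<le> real h" "\<And>m. real (ex_num m T) \<le> p * real m"
      "(real k - 2) * p * real n \<le> (real k - 1) * real (ex_num n T)"
  shows "real (card (nim_edges n c T))
    \<le> (real k - 1) * real (ex_num n T) + real (h * (k * (k * (4 * k * h + 2))))"
proof -
  define b where "b = 4 * k * h + 2"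
  define V where "V = {..<n}"
  define N where "N l = V - core h (colour_class n c l) V" for l
  define M where "M l = {e \<in> nim_edges n c T. c e = l}" for l
  have V: "finite V" "card V = n" by (auto simp: V_def)
  have cl: "c e < k" if "e \<in> [V]\<^bsup>2\<^esup>" for e
    using c that by (auto simp: edge_colourings_def complete_graph_def V_def)
  have classes: "[V]\<^bsup>2\<^esup> = (\<Union>l<k. colour_class n c l)"
    using cl by (auto simp: colour_class_def V_def)
  have M_sub: "M l \<subseteq> [V]\<^bsup>2\<^esup>" for l
    using nim_edges_subset[of n c T] by (auto simp: M_def V_def)
  have "nim_edges n c T = (\<Union>l<k. M l)"
    using cl nim_edges_subset[of n c T] by (auto simp: M_def V_def)
  then have "card (nim_edges n c T) \<le> (\<Sum>l<k. card (M l))"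
    using card_UN_le[of "{..<k}" M] by simp
  then have nim_le: "real (card (nim_edges n c T)) \<le> (\<Sum>l<k. real (card (M l)))"
    by (metis of_nat_le_iff of_nat_sum)
  have M_free: "copies T (V, M l) = {}" for l
    unfolding V_def M_def by (rule copies_nim_class_empty[OF T(2)])
  have M_le: "card (M l) \<le> ex_num n T" for l
    using card_le_ex_num[OF T(2) V(1) M_sub M_free, of l] V(2) by simp
  have "M l \<subseteq> [N l]\<^bsup>2\<^esup>" for l
  proof
    fix e assume "e \<in> M l"
    then have "e \<inter> core h (colour_class n c l) V = {}" "e \<in> [V]\<^bsup>2\<^esup>"
      using nim_class_avoids_core[OF T(1,2)] T(3) M_sub[of l] by (auto simp: M_def V_def)
    then show "e \<in> [N l]\<^bsup>2\<^esup>" by (auto simp: N_def nsets_def)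
  qed
  then have M_le_N: "card (M l) \<le> ex_num (card (N l)) T" for l
    using V(1) copies_empty_mono[OF M_free, of "N l" "M l"]
    by (intro card_le_ex_num[OF T(2)]) (auto simp: N_def)
  show ?thesis
  proof (cases "\<exists>i<k. card (N i) < b")
    \<comment> \<open>Colour \<open>i\<close> gives a constant number of NIM-edges, and each of the
      other \<open>k - 1\<close> colours at most the Turan number.\<close>
    case True
    then obtain i where i: "i < k" "card (N i) < b" by blast
    have "card (M i) \<le> h * card (N i)"
      using M_le_N[of i] ex_num_le[OF T(1,2), of "card (N i)"] T(3) by simp
    also have "\<dots> \<le> h * b" using i(2) by simp
    also have "\<dots> \<le> h * (k * (k * b))" using k by simp
    finally have Mi: "real (card (M i)) \<le> real (h * (k * (k * b)))"
      by (rule of_nat_mono)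
    have "(\<Sum>l<k. real (card (M l))) = real (card (M i)) + (\<Sum>l\<in>{..<k} - {i}. real (card (M l)))"
      using i(1) by (intro sum.remove) auto
    also have "\<dots> \<le> real (h * (k * (k * b))) + (\<Sum>l\<in>{..<k} - {i}. real (ex_num n T))"
      by (intro add_mono Mi sum_mono of_nat_mono M_le)
    also have "\<dots> = real (h * (k * (k * b))) + (real k - 1) * real (ex_num n T)"
      using i(1) by (simp add: of_nat_diff)
    finally show ?thesis using nim_le by (simp add: b_def)
  next
    case False
    \<comment> \<open>A vertex in \<open>N l\<close> for all \<open>l \<noteq> i\<close> avoids
      every core except possibly that of colour \<open>i\<close>, which \<open>N i\<close> avoids.
      Here \<open>N i\<close> is large, so the other set is small.\<close>
    have small: "card {v \<in> V. \<forall>l<k. l \<noteq> i \<longrightarrow> v \<in> N l} \<le> b" if "i < k" for i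
    proof -
      have "card {v \<in> V. \<forall>l<k. l \<noteq> i \<longrightarrow> v \<in> N l} < 4 * k * h + 2 \<or> card (N i) < 4 * k * h + 2"
        by (rule coreless_pair_small[OF V(1) classes]) (auto simp: N_def)
      then show ?thesis using False that by (auto simp: b_def)
    qed
    have "(\<Sum>l<k. card (N l)) \<le> (k - 2) * card V + k * (k * b)"
      by (rule sum_card_le[OF V(1) k _ small]) (auto simp: N_def)
    then have "real (\<Sum>l<k. card (N l)) \<le> real ((k - 2) * n + k * (k * b))"
      using V(2) by (metis of_nat_mono)
    then have N_le: "(\<Sum>l<k. real (card (N l))) \<le> (real k - 2) * real n + real (k * (k * b))"
      using k by (simp add: of_nat_diff)
    have "(\<Sum>l<k. real (card (M l))) \<le> (\<Sum>l<k. p * real (card (N l)))"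
      by (intro sum_mono order_trans[OF of_nat_mono[OF M_le_N]] p(3))
    also have "\<dots> = p * (\<Sum>l<k. real (card (N l)))" by (simp add: sum_distrib_left)
    also have "\<dots> \<le> p * ((real k - 2) * real n + real (k * (k * b)))"
      by (intro mult_left_mono N_le p(1))
    also have "\<dots> = (real k - 2) * p * real n + p * real (k * (k * b))"
      by (simp add: algebra_simps)
    \<comment> \<open>The last assumption on \<open>p\<close> absorbs the linear term, and
      \<open>p \<le> h\<close> makes the error independent of \<open>T\<close> beyond
      \<open>h\<close>.\<close>
    also have "\<dots> \<le> (real k - 1) * real (ex_num n T) + real h * real (k * (k * b))"
      by (intro add_mono p(4) mult_right_mono p(2)) simp
    finally show ?thesis using nim_le by (simp add: b_def)
  qed
qed

subsection \<open>The density of the Turan number of a tree\<close>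

text \<open>No edge joins \<open>V1\<close> to \<open>V2\<close>, so following walks of the
  connected graph \<open>T\<close> from \<open>v\<close> keeps all images in
  \<open>V1\<close>.\<close>

lemma connected_embedding_side:
  assumes "connected_graph T" "edges T \<subseteq> [verts T]\<^bsup>2\<^esup>" "V1 \<inter> V2 = {}"
    and "F1 \<subseteq> [V1]\<^bsup>2\<^esup>" "F2 \<subseteq> [V2]\<^bsup>2\<^esup>"
    and "inj_on f (verts T)" "\<And>e. e \<in> edges T \<Longrightarrow> f ` e \<in> F1 \<union> F2" "v \<in> verts T" "f v \<in> V1"
  shows "copies T (V1, F1) \<noteq> {}"
proof -
  have side: "f ` e \<in> F1" if "e \<in> edges T" "a \<in> e" "f a \<in> V1" for e a
  proof -
    have "f ` e \<notin> F2" using that assms(3,5) by (auto simp: nsets_def)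
    then show ?thesis using assms(7)[OF that(1)] by blast
  qed
  have "f w \<in> V1" if "w \<in> verts T" for w
  proof -
    have "(v, w) \<in> {(x, y). {x, y} \<in> edges T}\<^sup>*"
      using assms(1,8) that by (auto simp: connected_graph_def)
    then show ?thesis
    proof (induction rule: rtrancl_induct)
      case base
      show ?case by (rule assms(9))
    next
      case (step y z)
      then have "f ` {y, z} \<in> F1" by (intro side[of _ y]) auto
      then show ?case using assms(4) by (auto simp: nsets_def)
    qed
  qed
  then have V1: "f ` verts T \<subseteq> V1" by blast
  have "f ` e \<in> F1" if "e \<in> edges T" for e
  proof -
    have "e \<in> [verts T]\<^bsup>2\<^esup>" using assms(2) that by blast
    then obtain a b where "e = {a, b}" "a \<in> verts T" by (rule nsets2_E)
    then show ?thesis using side[OF that, of a] V1 by blast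
  qed
  then show ?thesis using copiesI[OF assms(6) V1] by blast
qed

text \<open>The disjoint union of two extremal graphs, the second shifted by \<open>a\<close>, stays
  \<open>T\<close>-free because a connected copy lies within one of them.\<close>

lemma ex_num_superadditive:
  assumes "connected_graph T" "fin_graph T" "edges T \<noteq> {}"
  shows "ex_num a T + ex_num b T \<le> ex_num (a + b) T"
proof -
  obtain F1 where F1: "F1 \<subseteq> [{..<a}]\<^bsup>2\<^esup>" "copies T ({..<a}, F1) = {}" "card F1 = ex_num a T"
    using ex_num_attained[OF assms(3)] .
  obtain F where F: "F \<subseteq> [{..<b}]\<^bsup>2\<^esup>" "copies T ({..<b}, F) = {}" "card F = ex_num b T"
    using ex_num_attained[OF assms(3)] .
  let ?g = "\<lambda>i. i + a"
  let ?V2 = "?g ` {..<b}" and ?F2 = "(`) ?g ` F"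
  have F2: "copies T (?V2, ?F2) = {}"
    by (rule copies_image_empty[OF _ F(1,2)]) simp
  have F2s: "?F2 \<subseteq> [?V2]\<^bsup>2\<^esup>"
  proof (rule image_subsetI)
    fix e assume "e \<in> F"
    then have "e \<in> [{..<b}]\<^bsup>2\<^esup>" using F(1) by blast
    then obtain x y where "e = {x, y}" "x \<in> {..<b}" "y \<in> {..<b}" "x \<noteq> y" by (rule nsets2_E)
    then show "?g ` e \<in> [?V2]\<^bsup>2\<^esup>" by simp
  qed
  have cF2: "card ?F2 = ex_num b T"
    using F(3) by (subst card_image) (auto intro!: inj_on_subset[OF inj_on_image_Pow[of ?g UNIV]])
  have disj: "{..<a} \<inter> ?V2 = {}" by auto
  have V: "{..<a} \<union> ?V2 = {..<a + b}"
  proof -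
    have "x \<in> ?V2" if "x < a + b" "\<not> x < a" for x
      using that by (intro image_eqI[of _ _ "x - a"]) auto
    then show ?thesis by auto
  qed
  have "copies T ({..<a + b}, F1 \<union> ?F2) = {}"
    unfolding copies_eq_empty_iff
  proof
    assume "\<exists>f. inj_on f (verts T) \<and> f ` verts T \<subseteq> {..<a + b} \<and> (\<forall>e\<in>edges T. f ` e \<in> F1 \<union> ?F2)"
    then obtain f where f: "inj_on f (verts T)" "f ` verts T \<subseteq> {..<a + b}"
      "\<forall>e\<in>edges T. f ` e \<in> F1 \<union> ?F2" by (elim exE conjE)
    obtain v where v: "v \<in> verts T" using assms(1) by (auto simp: connected_graph_def)
    have ed: "edges T \<subseteq> [verts T]\<^bsup>2\<^esup>" using assms(2) by (simp add: fin_graph_def)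
    have "f v \<in> {..<a} \<union> ?V2" using f(2) v unfolding V by blast
    then consider "f v \<in> {..<a}" | "f v \<in> ?V2" by blast
    then show False
    proof cases
      case 1
      show False
        using connected_embedding_side[OF assms(1) ed disj F1(1) F2s f(1) bspec[OF f(3)] v 1] F1(2) by blast
    next
      case 2
      have disj': "?V2 \<inter> {..<a} = {}" using disj by blast
      have "f ` e \<in> ?F2 \<union> F1" if "e \<in> edges T" for e
        using bspec[OF f(3) that] by blast
      from connected_embedding_side[OF assms(1) ed disj' F2s F1(1) f(1) this v 2] F2
      show False by blast
    qed
  qed
  moreover have "F1 \<union> ?F2 \<subseteq> [{..<a + b}]\<^bsup>2\<^esup>"
  proof (rule Un_least)
    show "F1 \<subseteq> [{..<a + b}]\<^bsup>2\<^esup>"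
      using F1(1) by (rule order_trans) (intro nsets_mono, simp)
    show "?F2 \<subseteq> [{..<a + b}]\<^bsup>2\<^esup>"
      using F2s by (rule order_trans) (intro nsets_mono, use V in blast)
  qed
  ultimately have "card (F1 \<union> ?F2) \<le> ex_num (a + b) T"
    using card_le_ex_num[OF assms(3), of "{..<a + b}" "F1 \<union> ?F2"] by simp
  moreover have "F1 \<inter> ?F2 = {}"
  proof -
    have "[{..<a}]\<^bsup>2\<^esup> \<inter> [?V2]\<^bsup>2\<^esup> = {}"
    proof (rule ccontr)
      assume "[{..<a}]\<^bsup>2\<^esup> \<inter> [?V2]\<^bsup>2\<^esup> \<noteq> {}"
      then obtain e where e: "e \<in> [{..<a}]\<^bsup>2\<^esup>" "e \<in> [?V2]\<^bsup>2\<^esup>" by blast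
      then obtain x where "x \<in> e" by (elim nsets2_E) blast
      with e have "x \<in> {..<a} \<inter> ?V2" unfolding nsets_def by blast
      then show False unfolding disj by simp
    qed
    then show ?thesis using F1(1) F2s by blast
  qed
  moreover have "finite F1" "finite ?F2"
    using F1(1) F(1) by (meson finite_imageI finite_imp_finite_nsets finite_lessThan finite_subset)+
  ultimately show ?thesis
    using F1(3) cF2 by (simp add: card_Un_disjoint)
qed

lemma ex_num_mult:
  assumes "connected_graph T" "fin_graph T" "edges T \<noteq> {}"
  shows "q * ex_num m T \<le> ex_num (q * m) T"
proof (induction q)
  case (Suc q)
  then show ?case using ex_num_superadditive[OF assms, of m "q * m"] by simp
qed simp

text \<open>For \<open>k = 2\<close> the coefficient of \<open>p\<close> vanishes in the last claim
  and the linear bound \<open>p = h\<close> suffices. For trees, \<open>p\<close> is the supremum of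
  the densities; as in Fekete's lemma, superadditivity brings the density above any fixed fraction
  of \<open>p\<close> for large \<open>n\<close>.\<close>

lemma ex_num_density:
  assumes "forest T" "edges T \<noteq> {}" "card (verts T) = h" "2 \<le> k" "k = 2 \<or> tree T"
  obtains p :: real where "0 \<le> p" "p \<le> real h" "\<forall>m. real (ex_num m T) \<le> p * real m"
    "\<forall>\<^sub>F n in sequentially. (real k - 2) * p * real n \<le> (real k - 1) * real (ex_num n T)"
proof (cases "k = 2")
  case True
  have "real (ex_num m T) \<le> real h * real m" for m
    using ex_num_le[OF assms(1,2), of m] assms(3) by (metis of_nat_le_iff of_nat_mult)
  then show ?thesis using that[of "real h"] True by simp
next
  case False
  with assms(5) have conn: "connected_graph T" and fin: "fin_graph T"
    by (auto simp: tree_def forest_def)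
  note super = ex_num_superadditive[OF conn fin assms(2)] and mult = ex_num_mult[OF conn fin assms(2)]
  \<comment> \<open>Division by zero gives \<open>d 0 = 0\<close>, which yields
    \<open>0 \<le> p\<close> and later excludes \<open>m = 0\<close>.\<close>
  define d where "d m = real (ex_num m T) / real m" for m
  have d_le: "d m \<le> real h" for m
  proof -
    have "real (ex_num m T) \<le> real h * real m"
      using ex_num_le[OF assms(1,2), of m] assms(3) by (metis of_nat_le_iff of_nat_mult)
    then show ?thesis by (cases "m = 0") (auto simp: d_def divide_le_eq)
  qed
  have bdd: "bdd_above (range d)" using d_le by (auto intro!: bdd_aboveI[of _ "real h"])
  define p where "p = Sup (range d)"
  have d_p: "d m \<le> p" for m unfolding p_def by (rule cSup_upper[OF _ bdd]) simp
  have p0: "0 \<le> p" using d_p[of 0] by (simp add: d_def)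
  have ph: "p \<le> real h" unfolding p_def by (rule cSup_least) (use d_le in auto)
  have ex_p: "real (ex_num m T) \<le> p * real m" for m
  proof (cases "m = 0")
    case True
    then show ?thesis using ex_num_le[OF assms(1,2), of 0] by simp
  next
    case False
    then show ?thesis using d_p[of m] by (simp add: d_def divide_le_eq)
  qed
  have "\<forall>\<^sub>F n in sequentially. (real k - 2) * p * real n \<le> (real k - 1) * real (ex_num n T)"
  proof (cases "p = 0")
    case True
    then show ?thesis using assms(4) by simp
  next
    case False
    \<comment> \<open>The fraction of \<open>p\<close> that is required. Since \<open>r < 1\<close>,
      some fixed \<open>m\<close> has density strictly above \<open>r * p\<close>.\<close>
    define r where "r = (real k - 2) / (real k - 1)"
    have k1: "real k - 1 > 0" using assms(4) by simp
    have "r < 1" using k1 by (simp add: r_def divide_less_eq)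
    then have "r * p < p" using False p0 by simp
    then obtain m where m: "r * p < d m"
      unfolding p_def using less_cSup_iff[OF _ bdd] by auto
    have "0 \<le> r * p" using assms(4) p0 by (simp add: r_def)
    then have m0: "m > 0" using m by (cases "m = 0") (auto simp: d_def)
    \<comment> \<open>From this threshold on, the surplus density times \<open>n\<close> pays for
      the incomplete block left when \<open>n\<close> is cut into blocks of size
      \<open>m\<close>.\<close>
    have "\<forall>\<^sub>F n in sequentially. real (ex_num m T) / (d m - r * p) \<le> real n"
      using filterlim_real_sequentially unfolding filterlim_at_top by blast
    then show ?thesis
    proof eventually_elim
      case (elim n)
      have "real n = real (n div m * m) + real (n mod m)"
        by (metis div_mult_mod_eq of_nat_add)
      also have "\<dots> \<le> real (n div m) * real m + real m"
        using m0 by (simp add: less_imp_le)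
      finally have "d m * real n \<le> d m * (real (n div m) * real m + real m)"
        by (intro mult_left_mono) (simp_all add: d_def)
      also have "\<dots> = real (n div m) * real (ex_num m T) + real (ex_num m T)"
        using m0 by (simp add: d_def field_simps)
      also have "real (n div m) * real (ex_num m T) \<le> real (ex_num n T)"
      proof -
        have "n div m * ex_num m T \<le> ex_num (n div m * m) T" by (rule mult)
        also have "\<dots> \<le> ex_num n T"
          using super[of "n div m * m" "n mod m"] by simp
        finally show ?thesis by (metis of_nat_le_iff of_nat_mult)
      qed
      finally have "d m * real n \<le> real (ex_num n T) + real (ex_num m T)" by simp
      moreover have "real (ex_num m T) \<le> real n * (d m - r * p)"
        using elim m by (simp add: divide_le_eq)
      ultimately have "r * p * real n \<le> real (ex_num n T)" by (simp add: algebra_simps)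
      then have "(real k - 1) * (r * p * real n) \<le> (real k - 1) * real (ex_num n T)"
        using k1 by (intro mult_left_mono) auto
      moreover have "(real k - 1) * (r * p * real n) = (real k - 2) * p * real n"
        using k1 by (simp add: r_def)
      ultimately show ?case by simp
    qed
  qed
  then show ?thesis using that p0 ph ex_p by blast
qed

subsection \<open>Lower bound\<close>

lemma permutes_pair_transitive:
  assumes "u \<in> [V]\<^bsup>2\<^esup>" "u' \<in> [V]\<^bsup>2\<^esup>"
  obtains q where "q permutes V" "q ` u = u'"
proof -
  obtain a b where u: "u = {a, b}" "a \<in> V" "b \<in> V" "a \<noteq> b" using assms(1) by (rule nsets2_E)
  obtain c d where u': "u' = {c, d}" "c \<in> V" "d \<in> V" "c \<noteq> d" using assms(2) by (rule nsets2_E)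
  \<comment> \<open>The position of \<open>b\<close> after \<open>a\<close> has moved to
    \<open>c\<close>. It differs from \<open>c\<close>, so the second swap leaves \<open>c\<close>
    in place.\<close>
  define b1 where "b1 = transpose a c b"
  have b1: "b1 \<in> V" "b1 \<noteq> c" using u u' by (auto simp: b1_def transpose_def)
  let ?q = "transpose b1 d \<circ> transpose a c"
  have "?q permutes V"
    using u(2) u'(2,3) b1(1) by (intro permutes_compose permutes_swap_id)
  moreover have "?q ` u = u'"
    using u(1) u' b1(2) by (simp add: b1_def[symmetric] transpose_def[of b1 d c])
  ultimately show ?thesis using that by blast
qed

text \<open>A uniformly random permutation sends \<open>g\<close> to every pair equally often:
  composing with a permutation that takes \<open>u\<close> to \<open>u'\<close> injects one fibre
  into the other.\<close>

lemma card_permutations_mapping_pair: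
  assumes "finite V" "g \<in> [V]\<^bsup>2\<^esup>" "u \<in> [V]\<^bsup>2\<^esup>"
  shows "card ([V]\<^bsup>2\<^esup>) * card {p. p permutes V \<and> p ` g = u} = card {p. p permutes V}"
proof -
  let ?N = "\<lambda>u. {p. p permutes V \<and> p ` g = u}"
  have fin: "finite {p. p permutes V}" "finite ([V]\<^bsup>2\<^esup>)"
    using assms(1) by (simp_all add: finite_permutations finite_imp_finite_nsets)
  have le: "card (?N u) \<le> card (?N u')" if uu': "u \<in> [V]\<^bsup>2\<^esup>" "u' \<in> [V]\<^bsup>2\<^esup>" for u u'
  proof -
    obtain q where q: "q permutes V" "q ` u = u'"
      using permutes_pair_transitive[OF uu'] .
    have "inj_on ((\<circ>) q) (?N u)"
      using fun.inj_map[OF permutes_inj[OF q(1)]] by (rule inj_on_subset) simp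
    moreover have "(\<circ>) q ` ?N u \<subseteq> ?N u'"
      using q by (auto simp: permutes_compose image_comp[symmetric])
    moreover have "finite (?N u')" using fin(1) by simp
    ultimately show ?thesis by (rule card_inj_on_le)
  qed
  have "{p. p permutes V} = (\<Union>u'\<in>[V]\<^bsup>2\<^esup>. ?N u')"
  proof -
    have "p ` g \<in> [V]\<^bsup>2\<^esup>" if "p permutes V" for p
    proof -
      obtain a b where "g = {a, b}" "a \<in> V" "b \<in> V" "a \<noteq> b" using assms(2) by (rule nsets2_E)
      then show ?thesis
        using that permutes_inj[OF that] by (simp add: permutes_in_image inj_eq)
    qed
    then show ?thesis by blast
  qed
  then have "card {p. p permutes V} = card (\<Union>u'\<in>[V]\<^bsup>2\<^esup>. ?N u')" by simp
  also have "\<dots> = (\<Sum>u'\<in>[V]\<^bsup>2\<^esup>. card (?N u'))"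
    using fin by (intro card_UN_disjoint) auto
  also have "\<dots> = (\<Sum>u'\<in>[V]\<^bsup>2\<^esup>. card (?N u))"
    using le assms(3) by (intro sum.cong refl antisym) auto
  finally show ?thesis by simp
qed

text \<open>Averaging over all permutations \<open>p\<close>.\<close>

lemma permutation_small_overlap:
  assumes "finite V" "U \<subseteq> [V]\<^bsup>2\<^esup>" "G \<subseteq> [V]\<^bsup>2\<^esup>"
  obtains p where "p permutes V" "card ([V]\<^bsup>2\<^esup>) * card (U \<inter> (`) p ` G) \<le> card U * card G"
proof (rule ccontr)
  assume "\<not> thesis"
  then have big: "card U * card G < card ([V]\<^bsup>2\<^esup>) * card (U \<inter> (`) p ` G)" if "p permutes V" for p
    using that \<open>\<And>p. p permutes V \<Longrightarrow> _ \<Longrightarrow> thesis\<close> by (meson not_le)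
  let ?P = "{p. p permutes V}"
  have fin: "finite ?P" "finite ([V]\<^bsup>2\<^esup>)"
    using assms(1) by (simp_all add: finite_permutations finite_imp_finite_nsets)
  have finU: "finite U" and finG: "finite G" using assms(2,3) fin(2) by (auto intro: finite_subset)
  have "id \<in> ?P" by (simp add: permutes_id)
  then have "(\<Sum>p\<in>?P. card U * card G) < (\<Sum>p\<in>?P. card ([V]\<^bsup>2\<^esup>) * card (U \<inter> (`) p ` G))"
    using fin(1) big by (intro sum_strict_mono) blast+
  also have "\<dots> = card ([V]\<^bsup>2\<^esup>) * (\<Sum>p\<in>?P. card (U \<inter> (`) p ` G))"
    by (simp add: sum_distrib_left)
  also have "\<dots> \<le> card ([V]\<^bsup>2\<^esup>) * (\<Sum>p\<in>?P. \<Sum>g\<in>G. \<Sum>u\<in>U. of_bool (p ` g = u))"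
  proof (intro mult_le_mono2 sum_mono)
    fix p
    have "U \<inter> (`) p ` G \<subseteq> (`) p ` {g \<in> G. p ` g \<in> U}" by auto
    then have "card (U \<inter> (`) p ` G) \<le> card ((`) p ` {g \<in> G. p ` g \<in> U})"
      using finG by (intro card_mono) auto
    also have "\<dots> \<le> card {g \<in> G. p ` g \<in> U}"
      using finG by (intro card_image_le) simp
    also have "\<dots> = (\<Sum>g\<in>G. of_bool (p ` g \<in> U))"
      using finG by (simp add: sum.If_cases of_bool_def Int_def)
    also have "\<dots> = (\<Sum>g\<in>G. \<Sum>u\<in>U. of_bool (p ` g = u))"
      using finU by (intro sum.cong refl) (simp add: of_bool_def)
    finally show "card (U \<inter> (`) p ` G) \<le> (\<Sum>g\<in>G. \<Sum>u\<in>U. of_bool (p ` g = u))" .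
  qed
  also have "\<dots> = card ([V]\<^bsup>2\<^esup>) * (\<Sum>g\<in>G. \<Sum>u\<in>U. \<Sum>p\<in>?P. of_bool (p ` g = u))"
  proof -
    have "(\<Sum>p\<in>?P. \<Sum>g\<in>G. \<Sum>u\<in>U. of_bool (p ` g = u) :: nat)
        = (\<Sum>g\<in>G. \<Sum>p\<in>?P. \<Sum>u\<in>U. of_bool (p ` g = u))" by (rule sum.swap)
    also have "\<dots> = (\<Sum>g\<in>G. \<Sum>u\<in>U. \<Sum>p\<in>?P. of_bool (p ` g = u))"
      by (intro sum.cong refl, rule sum.swap)
    finally show ?thesis by simp
  qed
  also have "\<dots> = (\<Sum>g\<in>G. \<Sum>u\<in>U. card ([V]\<^bsup>2\<^esup>) * card {p. p permutes V \<and> p ` g = u})"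
    using fin(1) by (simp add: sum_distrib_left of_bool_def sum.If_cases Int_def)
  also have "\<dots> = (\<Sum>g\<in>G. \<Sum>u\<in>U. card ?P)"
    using assms by (intro sum.cong refl card_permutations_mapping_pair) auto
  finally show False by (simp add: mult.commute mult.left_commute)
qed

text \<open>Copies are added one by one, each chosen to overlap little with the union so far. Both
  the union and \<open>G\<close> have linearly many edges among quadratically many pairs, so the
  average overlap is bounded; \<open>j \<le> k\<close> gives the same constant in every
  round.\<close>

lemma packing_permuted_copies:
  assumes "finite V" "2 \<le> card V" "G \<subseteq> [V]\<^bsup>2\<^esup>" "card G \<le> h * card V" "j \<le> k"
  shows "\<exists>Q :: nat \<Rightarrow> 'a \<Rightarrow> 'a. (\<forall>i<j. Q i permutes V) \<and>
    j * card G \<le> card (\<Union>i<j. (`) (Q i) ` G) + j * (4 * k * h * h)"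
  using assms(5)
proof (induction j)
  case 0
  then show ?case by simp
next
  case (Suc j)
  then obtain Q where Q: "\<forall>i<j. Q i permutes V"
    "j * card G \<le> card (\<Union>i<j. (`) (Q i) ` G) + j * (4 * k * h * h)" by auto
  let ?E = "[V]\<^bsup>2\<^esup>" and ?n = "card V"
  let ?U = "\<Union>i<j. (`) (Q i) ` G"
  have finE: "finite ?E" using assms(1) by (rule finite_imp_finite_nsets)
  then have finG: "finite G" using assms(3) by (rule finite_subset[rotated])
  have image_E: "(`) p ` G \<subseteq> ?E" if "p permutes V" for p
  proof (rule image_subsetI)
    fix g assume "g \<in> G"
    then have "g \<in> ?E" using assms(3) by blast
    then obtain a b where "g = {a, b}" "a \<in> V" "b \<in> V" "a \<noteq> b" by (rule nsets2_E)
    then show "p ` g \<in> ?E"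
      using that permutes_inj[OF that] by (simp add: permutes_in_image inj_eq)
  qed
  have UE: "?U \<subseteq> ?E" using Q(1) image_E by blast
  obtain p where p: "p permutes V" "card ?E * card (?U \<inter> (`) p ` G) \<le> card ?U * card G"
    using permutation_small_overlap[OF assms(1) UE assms(3)] by blast
  have cU: "card ?U \<le> j * card G"
  proof -
    have "card ?U \<le> (\<Sum>i<j. card ((`) (Q i) ` G))" by (rule card_UN_le) simp
    also have "\<dots> \<le> (\<Sum>i<j. card G)" by (intro sum_mono card_image_le finG)
    finally show ?thesis by simp
  qed
  \<comment> \<open>This is where at least two vertices are required.\<close>
  have E: "?n * ?n \<le> 4 * card ?E" "0 < card ?E"
  proof -
    have "card ?E = ?n choose 2" by simp
    moreover have "even (?n * (?n - 1))" by auto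
    ultimately have "2 * card ?E = ?n * (?n - 1)"
      unfolding choose_two by (metis even_two_times_div_two)
    moreover have "?n * ?n \<le> 2 * (?n * (?n - 1))"
      using assms(2) by (cases ?n) auto
    ultimately show "?n * ?n \<le> 4 * card ?E" by linarith
    then show "0 < card ?E" using assms(2) by (cases "card ?E") auto
  qed
  have "card ?E * card (?U \<inter> (`) p ` G) \<le> (j * card G) * card G"
    using p(2) cU by (meson le_trans mult_le_mono1)
  also have "\<dots> = j * (card G * card G)" by simp
  also have "\<dots> \<le> k * ((h * ?n) * (h * ?n))"
    using Suc.prems by (intro mult_le_mono assms(4)) simp
  also have "\<dots> = k * h * h * (?n * ?n)" by simp
  also have "\<dots> \<le> k * h * h * (4 * card ?E)" by (intro mult_le_mono2 E(1))
  also have "\<dots> = card ?E * (4 * k * h * h)" by simp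
  finally have overlap: "card (?U \<inter> (`) p ` G) \<le> 4 * k * h * h"
    using E(2) by simp
  have "inj_on ((`) p) G"
    using inj_on_image_Pow[OF permutes_inj[OF p(1)]] by (rule inj_on_subset) simp
  then have cG: "card ((`) p ` G) = card G" by (rule card_image)
  have "card ?U + card ((`) p ` G) = card (?U \<union> (`) p ` G) + card (?U \<inter> (`) p ` G)"
    by (rule card_Un_Int) (use finite_subset[OF UE finE] finG in auto)
  then have "Suc j * card G \<le> card (?U \<union> (`) p ` G) + Suc j * (4 * k * h * h)"
    using Q(2) overlap cG by simp
  moreover have "(\<Union>i<Suc j. (`) ((Q(j := p)) i) ` G) = ?U \<union> (`) p ` G"
    by (auto simp: lessThan_Suc)
  moreover have "\<forall>i<Suc j. (Q(j := p)) i permutes V"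
    using Q(1) p(1) by (auto simp: less_Suc_eq)
  ultimately show ?case by metis
qed

section \<open>Colourings built from \<open>T\<close>-free graphs\<close>

lemma card_nim_edges_le_nim:
  assumes "0 < k" "c \<in> edge_colourings k n"
  shows "card (nim_edges n c T) \<le> nim k n T"
  unfolding nim_def by (rule Max_ge[OF nim_set(1)[OF assms(1)]]) (use assms(2) in blast)

text \<open>Each covered edge gets the least index of a graph containing it, all other edges the
  spare colour \<open>j\<close>. A monochromatic copy through a covered edge would lie in a single
  \<open>T\<close>-free graph. Overlaps between the graphs do no harm.\<close>

lemma card_Union_free_le_nim:
  assumes "\<And>i. i < j \<Longrightarrow> G i \<subseteq> [{..<n}]\<^bsup>2\<^esup>" "\<And>i. i < j \<Longrightarrow> copies T ({..<n}, G i) = {}"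
  shows "card (\<Union>i<j. G i) \<le> nim (Suc j) n T"
proof -
  define c where "c e = (if \<exists>i<j. e \<in> G i then LEAST i. i < j \<and> e \<in> G i else j)" for e
  have c: "c e < j \<and> e \<in> G (c e)" if "\<exists>i<j. e \<in> G i" for e
    using that LeastI_ex[of "\<lambda>i. i < j \<and> e \<in> G i"] by (simp add: c_def)
  have c': "e \<in> G (c e)" if "c e < j" for e
    using c[of e] that by (cases "\<exists>i<j. e \<in> G i") (simp_all add: c_def)
  have "c e < Suc j" for e
    using c[of e] by (cases "\<exists>i<j. e \<in> G i") (auto simp: c_def)
  then have col: "c \<in> edge_colourings (Suc j) n" by (auto simp: edge_colourings_def)
  have "(\<Union>i<j. G i) \<subseteq> nim_edges n c T"
  proof
    fix e assume "e \<in> (\<Union>i<j. G i)"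
    then have e: "c e < j" "e \<in> G (c e)" using c[of e] by auto
    have "e \<in> edges (complete_graph n)"
      using assms(1)[OF e(1)] e(2) by (auto simp: complete_graph_def)
    moreover have False
      if H: "H \<in> copies T (complete_graph n)" "e \<in> edges H" "\<forall>e'\<in>edges H. c e' = i" for H i
    proof -
      have "edges H \<subseteq> G (c e)"
      proof
        fix e' assume "e' \<in> edges H"
        then have "c e' = c e" using H(2,3) by metis
        then show "e' \<in> G (c e)" using c'[of e'] e(1) by simp
      qed
      then have "H \<in> copies T ({..<n}, G (c e))"
        using H(1) unfolding complete_graph_def by (rule copies_restrict[rotated])
      then show False using assms(2)[OF e(1)] by blast
    qed
    ultimately show "e \<in> nim_edges n c T"
      unfolding nim_edges_def by blast
  qed
  then have "card (\<Union>i<j. G i) \<le> card (nim_edges n c T)"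
    using finite_subset[OF nim_edges_subset finite_imp_finite_nsets[OF finite_lessThan]]
    by (intro card_mono)
  also have "\<dots> \<le> nim (Suc j) n T" by (rule card_nim_edges_le_nim[OF _ col]) simp
  finally show ?thesis .
qed

text \<open>The \<open>k - 1\<close> permuted copies of one extremal graph take one colour each, and
  the last colour is the spare one.\<close>

lemma nim_lower_bound:
  assumes "forest T" "edges T \<noteq> {}" "card (verts T) = h" "2 \<le> k" "2 \<le> n"
  shows "(k - 1) * ex_num n T \<le> nim k n T + k * (4 * k * h * h)"
proof -
  let ?V = "{..<n}"
  obtain G where G: "G \<subseteq> [?V]\<^bsup>2\<^esup>" "copies T (?V, G) = {}" "card G = ex_num n T"
    using ex_num_attained[OF assms(2)] .
  have "card G \<le> h * card ?V" using ex_num_le[OF assms(1,2)] G(3) assms(3) by simp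
  then obtain Q where Q: "\<forall>i<k - 1. Q i permutes ?V"
    "(k - 1) * card G \<le> card (\<Union>i<k - 1. (`) (Q i) ` G) + (k - 1) * (4 * k * h * h)"
    using packing_permuted_copies[of ?V G h "k - 1" k] G(1) assms(5) by auto
  have "card (\<Union>i<k - 1. (`) (Q i) ` G) \<le> nim (Suc (k - 1)) n T"
  proof (rule card_Union_free_le_nim)
    fix i assume "i < k - 1"
    then have p: "Q i permutes ?V" using Q(1) by blast
    show "(`) (Q i) ` G \<subseteq> [?V]\<^bsup>2\<^esup>"
    proof (rule image_subsetI)
      fix g assume "g \<in> G"
      then have "g \<in> [?V]\<^bsup>2\<^esup>" using G(1) by blast
      then obtain a b where "g = {a, b}" "a \<in> ?V" "b \<in> ?V" "a \<noteq> b" by (rule nsets2_E)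
      then show "Q i ` g \<in> [?V]\<^bsup>2\<^esup>"
        using permutes_in_image[OF p] permutes_inj[OF p] by (simp add: inj_eq)
    qed
    show "copies T (?V, (`) (Q i) ` G) = {}"
      using copies_image_empty[OF permutes_inj_on[OF p] G(1,2)] permutes_image[OF p] by simp
  qed
  moreover have "Suc (k - 1) = k" using assms(4) by simp
  ultimately have "card (\<Union>i<k - 1. (`) (Q i) ` G) \<le> nim k n T" by (simp only:)
  moreover have "(k - 1) * (4 * k * h * h) \<le> k * (4 * k * h * h)" by (intro mult_le_mono1) simp
  ultimately show ?thesis using order_trans[OF Q(2) add_mono] unfolding G(3) by blast
qed

text \<open>\<open>C\<close> is chosen before \<open>T\<close>, so it depends on \<open>k\<close>
  and \<open>h\<close> only, while the threshold for \<open>n\<close> may depend on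
  \<open>T\<close>. Requiring an edge keeps \<open>ex_num\<close> meaningful for large
  \<open>n\<close>.\<close>

theorem theorem1p13:
  fixes k h :: nat
  assumes "k \<ge> 2"
  shows "\<exists>C::real. \<forall>T::'a graph.
    forest T \<and> card (verts T) = h \<and> edges T \<noteq> {} \<and> (k = 2 \<or> tree T) \<longrightarrow>
    (\<forall>\<^sub>F n in sequentially.
      \<bar>real (nim k n T) - (real k - 1) * real (ex_num n T)\<bar> \<le> C)"
proof (intro exI allI impI)
  let ?U = "real (h * (k * (k * (4 * k * h + 2))))" and ?L = "real (k * (4 * k * h * h))"
  fix T :: "'a graph"
  assume "forest T \<and> card (verts T) = h \<and> edges T \<noteq> {} \<and> (k = 2 \<or> tree T)"
  then have T: "forest T" "edges T \<noteq> {}" "card (verts T) = h" "k = 2 \<or> tree T" by blast+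
  obtain p :: real where p: "0 \<le> p" "p \<le> real h" "\<forall>m. real (ex_num m T) \<le> p * real m"
    and ev: "\<forall>\<^sub>F n in sequentially. (real k - 2) * p * real n \<le> (real k - 1) * real (ex_num n T)"
    using ex_num_density[OF T(1-3) assms T(4)] .
  show "\<forall>\<^sub>F n in sequentially. \<bar>real (nim k n T) - (real k - 1) * real (ex_num n T)\<bar> \<le> ?U + ?L"
    using ev eventually_ge_at_top[of 2]
  proof eventually_elim
    case (elim n)
    \<comment> \<open>The maximum is attained by a colouring, to which the upper bound
      applies.\<close>
    have "nim k n T \<in> {card (nim_edges n c T) | c. c \<in> edge_colourings k n}"
      unfolding nim_def by (rule Max_in) (use assms in \<open>intro nim_set, simp\<close>)+
    then obtain c where c: "c \<in> edge_colourings k n" "nim k n T = card (nim_edges n c T)" by blast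
    have "real (nim k n T) \<le> (real k - 1) * real (ex_num n T) + ?U"
      unfolding c(2) by (rule card_nim_edges_le[OF T(1-3) assms c(1) p(1,2) spec[OF p(3)] elim(1)])
    moreover have "real ((k - 1) * ex_num n T) \<le> real (nim k n T + k * (4 * k * h * h))"
      by (rule of_nat_mono[OF nim_lower_bound[OF T(1-3) assms elim(2)]])
    then have "(real k - 1) * real (ex_num n T) \<le> real (nim k n T) + ?L"
      using assms by (simp add: of_nat_diff)
    moreover have "0 \<le> ?U" "0 \<le> ?L" by (rule of_nat_0_le_iff)+
    ultimately show ?case unfolding abs_le_iff by linarith
  qed
qed

end
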